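(* For every positive integer $m$, $$ R (S (2m, m)) \leq \lceil 4.27492\,m\rceil + 1.$$
   Context: All graphs are finite and simple. For non-negative integers $m_1,m_2$, the double star $S(m_1,m_2)$ is the tree obtained from a star with $m_1$ leaves and a vertex-disjoint star with $m_2$ leaves by adding an edge joining their centres (so it has $m_1+m_2+2$ vertices). For a graph $H$, the (two-colour) Ramsey number $R(H)$ is the smallest integer $n$ such that every colouring of the edges of the complete graph $K_n$ with two colours contains a monochromatic copy of $H$ (as a not necessarily induced subgraph). *)

theory Defs
  imports Complex_Main "HOL-Library.Ramsey"
begin

(* A graph is a pair of a vertex set and a set of edges, each edge a two-element vertex set. *)

type_synonym 'a graph = "'a set \<times> 'a set set"

abbreviation verts :: "'a graph \<Rightarrow> 'a set" where "verts \<equiv> fst"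
abbreviation edges :: "'a graph \<Rightarrow> 'a set set" where "edges \<equiv> snd"

definition finite_simple_graph :: "'a graph \<Rightarrow> bool" where
  "finite_simple_graph G \<longleftrightarrow> finite (verts G) \<and> edges G \<subseteq> [verts G]\<^bsup>2\<^esup>"

(* The subgraph need not be induced. *)
definition contains_copy :: "'a graph \<Rightarrow> 'b graph \<Rightarrow> bool" where
  "contains_copy G H \<longleftrightarrow>
     (\<exists>f. inj_on f (verts H) \<and> f ` verts H \<subseteq> verts G \<and> (\<forall>e\<in>edges H. f ` e \<in> edges G))"

definition colour_class :: "nat \<Rightarrow> (nat set \<Rightarrow> bool) \<Rightarrow> bool \<Rightarrow> nat graph" where
  "colour_class n c i = ({..<n}, {e \<in> [{..<n}]\<^bsup>2\<^esup>. c e = i})"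

(* Colourings are total functions, but only their values on the edges of the complete graph
   with vertex set {..<n} matter. *)
definition ramsey_arrows :: "nat \<Rightarrow> 'a graph \<Rightarrow> bool" where
  "ramsey_arrows n H \<longleftrightarrow>
     (\<forall>c :: nat set \<Rightarrow> bool. \<exists>i. contains_copy (colour_class n c i) H)"

definition ramsey_number :: "'a graph \<Rightarrow> nat" where
  "ramsey_number H = (LEAST n. ramsey_arrows n H)"

lemma ramsey_arrows_exists:
  assumes "finite_simple_graph H"
  shows "\<exists>n. ramsey_arrows n H"
proof -
  let ?k = "card (verts H)"
  obtain r where r: "\<And>(V::nat set) E. finite V \<Longrightarrow> card V \<ge> r \<Longrightarrow>
      \<exists>R\<subseteq>V. card R = ?k \<and> clique R E \<or> card R = ?k \<and> indep R E"
    using ramsey2[of ?k ?k] by metis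
  have "\<exists>i. contains_copy (colour_class r c i) H" for c
  proof -
    obtain R where R: "R \<subseteq> {..<r}" "card R = ?k" "clique R {e. c e} \<or> indep R {e. c e}"
      using r[of "{..<r}" "{e. c e}"] by auto
    have "finite R" using R(1) finite_subset by blast
    then obtain f where f: "bij_betw f (verts H) R"
      using assms R(2) finite_same_card_bij unfolding finite_simple_graph_def by metis
    obtain i where i: "\<And>v w. v \<in> R \<Longrightarrow> w \<in> R \<Longrightarrow> v \<noteq> w \<Longrightarrow> c {v, w} = i"
      using R(3) unfolding clique_def indep_def by auto
    have "f ` e \<in> edges (colour_class r c i)" if "e \<in> edges H" for e
    proof -
      obtain x y where e: "e = {x, y}" "x \<in> verts H" "y \<in> verts H" "x \<noteq> y"
        using \<open>e \<in> edges H\<close> assms unfolding finite_simple_graph_def by (meson nsets2_E subsetD)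
      then have "f x \<in> R" "f y \<in> R" "f x \<noteq> f y"
        using f by (auto simp: bij_betw_def inj_on_def)
      with R(1) i show ?thesis
        by (auto simp: colour_class_def e(1))
    qed
    moreover have "f ` verts H \<subseteq> verts (colour_class r c i)"
      using f R(1) by (auto simp: bij_betw_def colour_class_def)
    ultimately show ?thesis
      using f unfolding contains_copy_def bij_betw_def by blast
  qed
  then show ?thesis unfolding ramsey_arrows_def by blast
qed

(* Vertex (b, 0) is the centre of the star tagged b and (b, 1), ..., (b, m) are its leaves. *)
definition star :: "bool \<Rightarrow> nat \<Rightarrow> (bool \<times> nat) graph" where
  "star b m = ({b} \<times> {0..m}, {{(b, 0), (b, i)} | i. i \<in> {1..m}})"

definition double_star :: "nat \<Rightarrow> nat \<Rightarrow> (bool \<times> nat) graph" where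
  "double_star m1 m2 =
     (verts (star False m1) \<union> verts (star True m2),
      edges (star False m1) \<union> edges (star True m2) \<union> {{(False, 0), (True, 0)}})"

lemma finite_simple_graph_double_star: "finite_simple_graph (double_star m1 m2)"
  by (auto simp: finite_simple_graph_def double_star_def star_def)

lemma card_verts_double_star: "card (verts (double_star m1 m2)) = m1 + m2 + 2"
  unfolding double_star_def star_def fst_conv
  by (subst card_Un_disjoint) (auto simp: card_cartesian_product)

end

theory Submission
  imports Defs
begin

text \<open>
  In a colouring of the complete graph on \<open>n + 1\<close> vertices, \<open>n = a + b + \<delta>\<close>, without a
  monochromatic \<open>S(a, b)\<close>, all degrees in both colours lie between \<open>\<delta>\<close> and \<open>a + b\<close>. If \<open>uv\<close> is an
  edge of colour \<open>i\<close> and \<open>u\<close> has more than \<open>a\<close> neighbours in that colour, then \<open>u\<close> and \<open>v\<close> have at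
  least \<open>\<delta>\<close> common neighbours in the other colour. Hence every vertex has exactly one colour of
  degree more than \<open>a\<close>, its majority colour; let \<open>W v\<close> and \<open>S v\<close> be its majority and minority
  neighbourhoods, so \<open>card (S v) \<le> a\<close>.

  If both majority colours occurred, then \<open>card (S v \<inter> S w) \<le> a - \<delta>\<close> for \<open>v\<close>, \<open>w\<close> of different
  types, while every \<open>S z\<close> contains more than \<open>a - \<delta>\<close> vertices of the type of \<open>z\<close>; counting the
  triples \<open>z \<in> S v \<inter> S w\<close> over \<open>z\<close> contradicts this.

  If there is only one majority colour, fix \<open>v\<close>. At least \<open>card (W v) * \<delta>\<close> minority edges join
  \<open>W v\<close> and \<open>S v\<close>, so by the quadratic hypothesis on \<open>\<delta>\<close> some \<open>z \<in> S v\<close> has at least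
  \<open>2 * (a - \<delta>)\<close> of them. A common majority neighbour \<open>u\<close> of \<open>v\<close> and \<open>z\<close> would make both \<open>S v\<close> and
  \<open>S z\<close> meet \<open>S u\<close> in \<open>\<delta>\<close> vertices, leaving \<open>z\<close> with fewer edges into \<open>W v\<close>. So \<open>W v\<close> and \<open>W z\<close> are
  disjoint, which is impossible since both avoid \<open>v\<close> and contain at least half of the vertices.

  For \<open>a = 2 * m\<close> and \<open>b = m\<close> the quadratic condition reads \<open>\<delta> * (5 * m + \<delta>) \<ge> 8 * m\<^sup>2\<close>, whose
  positive root is \<open>\<delta> = 1.274917... * m\<close>.
\<close>

section \<open>Building a double star around an edge\<close>

lemma disjoint_subsets_of_cards:
  assumes fin: "finite P" "finite Q"
    and "a \<le> card P" "b \<le> card Q" "a + b \<le> card (P \<union> Q)"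
  obtains P' Q' where "P' \<subseteq> P" "Q' \<subseteq> Q" "card P' = a" "card Q' = b" "P' \<inter> Q' = {}"
proof (cases "a \<le> card (P - Q)")
  case True
  then obtain P' where "P' \<subseteq> P - Q" "card P' = a"
    by (meson obtain_subset_with_card_n)
  moreover obtain Q' where "Q' \<subseteq> Q" "card Q' = b"
    using assms(4) by (meson obtain_subset_with_card_n)
  ultimately show thesis by (intro that[of P' Q']) auto
next
  case False
  have "card P = card (P - Q) + card (P \<inter> Q)"
    using fin by (metis card_Diff_subset_Int card_mono finite_Int inf_le1 le_add_diff_inverse2)
  \<comment> \<open>\<open>P'\<close> uses up \<open>P - Q\<close> before touching the intersection,
    so \<open>X\<close> takes from \<open>Q\<close> no more than it must.\<close>
  then obtain X where X: "X \<subseteq> P \<inter> Q" "card X = a - card (P - Q)"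
    using assms(3) by (metis add.commute le_diff_conv obtain_subset_with_card_n)
  have finX: "finite X" using X(1) fin by (meson finite_Int finite_subset)
  have "card (P \<union> Q) = card (P - Q) + card Q"
    using fin by (metis Un_Diff_cancel2 card_Un_disjoint Diff_disjoint finite_Diff inf_commute)
  moreover have "card (Q - X) = card Q - card X"
    using X(1) finX by (intro card_Diff_subset) auto
  ultimately have "b \<le> card (Q - X)"
    using assms(5) X(2) False by linarith
  then obtain Q' where "Q' \<subseteq> Q - X" "card Q' = b"
    by (meson obtain_subset_with_card_n)
  moreover have "card ((P - Q) \<union> X) = a"
    using X fin finX False by (subst card_Un_disjoint) auto
  ultimately show thesis using X(1) by (intro that[of "(P - Q) \<union> X" Q']) auto
qed

lemma obtain_bij_betw_insert:
  assumes "finite P" "card P = a" "u \<notin> P"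
  obtains g where "bij_betw g {0..a::nat} (insert u P)" "g 0 = u"
proof -
  obtain g where "bij_betw g {1..a} P"
    using assms by (metis finite_same_card_bij finite_atLeastAtMost card_atLeastAtMost diff_Suc_1)
  then have "bij_betw (g(0 := u)) {1..a} P"
    by (subst bij_betw_cong[of _ _ g]) auto
  then have "bij_betw (g(0 := u)) ({1..a} \<union> {0}) (P \<union> {(g(0 := u)) 0})"
    using assms by (intro notIn_Un_bij_betw) auto
  moreover have "{1..a} \<union> {0} = {0..a}" by auto
  ultimately show thesis by (intro that[of "g(0 := u)"]) auto
qed

definition nbhd :: "'a set \<Rightarrow> ('a set \<Rightarrow> bool) \<Rightarrow> bool \<Rightarrow> 'a \<Rightarrow> 'a set" where
  "nbhd V c i v = {u \<in> V. u \<noteq> v \<and> c {v, u} = i}"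

text \<open>Each centre is a neighbour of the other, so as a supply of leaves each neighbourhood
  loses one vertex and their union loses two; the strict bounds absorb exactly this.\<close>

lemma contains_copy_double_star:
  assumes uv: "u < n" "v < n" "u \<noteq> v" "c {u, v} = i"
    and "a < card (nbhd {..<n} c i u)" "b < card (nbhd {..<n} c i v)"
    and "a + b + 1 < card (nbhd {..<n} c i u \<union> nbhd {..<n} c i v)"
  shows "contains_copy (colour_class n c i) (double_star a b)"
proof -
  define P where "P = nbhd {..<n} c i u - {v}"
  define Q where "Q = nbhd {..<n} c i v - {u}"
  have mem: "v \<in> nbhd {..<n} c i u" "u \<in> nbhd {..<n} c i v"
    using uv by (auto simp: nbhd_def insert_commute)
  have fin: "finite (nbhd {..<n} c i w)" for w by (simp add: nbhd_def)
  have "P \<union> Q = nbhd {..<n} c i u \<union> nbhd {..<n} c i v - {u, v}"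
    by (auto simp: P_def Q_def nbhd_def)
  then have "card (P \<union> Q) = card (nbhd {..<n} c i u \<union> nbhd {..<n} c i v - {u, v})"
    by simp
  moreover have "card (nbhd {..<n} c i u \<union> nbhd {..<n} c i v - {u, v})
      = card (nbhd {..<n} c i u \<union> nbhd {..<n} c i v) - 2"
    using mem uv(3) by (subst card_Diff_subset) auto
  moreover have "card P = card (nbhd {..<n} c i u) - 1" "card Q = card (nbhd {..<n} c i v) - 1"
    using mem by (simp_all add: P_def Q_def)
  ultimately have "a \<le> card P" "b \<le> card Q" "a + b \<le> card (P \<union> Q)"
    using assms(5-7) by linarith+
  moreover have "finite P" "finite Q" using fin by (simp_all add: P_def Q_def)
  ultimately obtain P' Q' where PQ: "P' \<subseteq> P" "Q' \<subseteq> Q" "card P' = a" "card Q' = b" "P' \<inter> Q' = {}"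
    using disjoint_subsets_of_cards by metis
  have "finite P'" "finite Q'"
    using PQ \<open>finite P\<close> \<open>finite Q\<close> finite_subset by auto
  moreover have "u \<notin> P'" "v \<notin> Q'" using PQ(1,2) by (auto simp: P_def Q_def nbhd_def)
  ultimately obtain g h where g: "bij_betw g {0..a} (insert u P')" "g 0 = u"
      and h: "bij_betw h {0..b} (insert v Q')" "h 0 = v"
    using PQ(3,4) obtain_bij_betw_insert by metis
  define f where "f = (\<lambda>(s, k). if s then h k else g k)"
  have verts: "verts (double_star a b) = {False} \<times> {0..a} \<union> {True} \<times> {0..b}"
    by (simp add: double_star_def star_def)
  have P': "x < n" "x \<noteq> u" "x \<noteq> v" "c {u, x} = i" if "x \<in> P'" for x
    using that PQ(1) by (auto simp: P_def nbhd_def)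
  have Q': "x < n" "x \<noteq> u" "x \<noteq> v" "c {v, x} = i" if "x \<in> Q'" for x
    using that PQ(2) by (auto simp: Q_def nbhd_def)
  have gh: "inj_on g {0..a}" "inj_on h {0..b}" "g ` {0..a} = insert u P'" "h ` {0..b} = insert v Q'"
    using g h by (auto simp: bij_betw_def)
  have g_mem: "g k \<in> insert u P'" if "k \<le> a" for k
    using gh(3) that by (metis atLeastAtMost_iff imageI le0)
  have h_mem: "h k \<in> insert v Q'" if "k \<le> b" for k
    using gh(4) that by (metis atLeastAtMost_iff imageI le0)
  have ne: "g k \<noteq> h l" if "k \<le> a" "l \<le> b" for k l
    using g_mem[OF that(1)] h_mem[OF that(2)] PQ(5) P'(3)[of "g k"] Q'(2)[of "h l"] uv(3) by auto
  have "(s, k) = (s', k')"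
    if "(s, k) \<in> verts (double_star a b)" "(s', k') \<in> verts (double_star a b)"
      and "f (s, k) = f (s', k')" for s k s' k'
    using that ne[of k k'] ne[of k' k] inj_onD[OF gh(1), of k k'] inj_onD[OF gh(2), of k k']
    unfolding verts f_def by (cases s; cases s') auto
  then have "inj_on f (verts (double_star a b))"
    by (auto intro!: inj_onI)
  moreover have "g k < n" if "k \<le> a" for k
    using g_mem[OF that] P'(1) uv(1) by auto
  moreover have "h k < n" if "k \<le> b" for k
    using h_mem[OF that] Q'(1) uv(2) by auto
  ultimately have "inj_on f (verts (double_star a b))"
    "f ` verts (double_star a b) \<subseteq> verts (colour_class n c i)"
    unfolding verts f_def colour_class_def by auto
  moreover have "f ` e \<in> edges (colour_class n c i)" if e: "e \<in> edges (double_star a b)" for e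
  proof -
    consider "e = {(False, 0), (True, 0)}"
      | k where "k \<in> {1..a}" "e = {(False, 0), (False, k)}"
      | k where "k \<in> {1..b}" "e = {(True, 0), (True, k)}"
      using e by (auto simp: double_star_def star_def)
    then show ?thesis
    proof cases
      case 1
      then show ?thesis using uv g(2) h(2) by (simp add: f_def colour_class_def)
    next
      case (2 k)
      then have "g k \<noteq> g 0" using inj_onD[OF gh(1), of k 0] by auto
      then have "g k \<in> P'" using g_mem[of k] g(2) 2(1) by auto
      then show ?thesis using 2 uv g(2) P'[of "g k"] by (simp add: f_def colour_class_def)
    next
      case (3 k)
      then have "h k \<noteq> h 0" using inj_onD[OF gh(2), of k 0] by auto
      then have "h k \<in> Q'" using h_mem[of k] h(2) 3(1) by auto
      then show ?thesis using 3 uv h(2) Q'[of "h k"] by (simp add: f_def colour_class_def)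
    qed
  qed
  ultimately show ?thesis unfolding contains_copy_def by blast
qed

section \<open>Degrees and common neighbourhoods without a monochromatic double star\<close>

locale double_star_free =
  fixes V :: "'a set" and c :: "'a set \<Rightarrow> bool" and a b \<delta> :: nat
  assumes finite_V: "finite V"
    and card_V: "card V = a + b + \<delta> + 1"
    and a_pos: "0 < a"
    and b_less: "b < \<delta>"
    and a_less: "a < b + \<delta>"
    and quad: "2 * a\<^sup>2 \<le> \<delta> * (2 * a + b + \<delta>)"
    and star_free: "\<lbrakk>u \<in> V; v \<in> V; u \<noteq> v; c {u, v} = i; a < card (nbhd V c i u); b < card (nbhd V c i v)\<rbrakk>
          \<Longrightarrow> card (nbhd V c i u \<union> nbhd V c i v) \<le> a + b + 1"
begin

abbreviation N where "N \<equiv> nbhd V c"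

declare finite_V [simp]

lemma N_subset: "N i v \<subseteq> V" and finite_N [simp]: "finite (N i v)"
  using finite_V by (auto simp: nbhd_def)

lemma N_sym: "u \<in> N i v \<longleftrightarrow> v \<in> N i u" if "u \<in> V" "v \<in> V"
  using that by (auto simp: nbhd_def insert_commute)

lemma not_self_N [simp]: "v \<notin> N i v"
  by (simp add: nbhd_def)

lemma card_N_add:
  assumes "v \<in> V" shows "card (N i v) + card (N (\<not> i) v) = a + b + \<delta>"
proof -
  have "N i v \<union> N (\<not> i) v = V - {v}" "N i v \<inter> N (\<not> i) v = {}"
    by (auto simp: nbhd_def)
  then have "card (N i v) + card (N (\<not> i) v) = card (V - {v})"
    by (metis card_Un_disjoint finite_N)
  then show ?thesis using assms card_V by simp
qed

text \<open>As \<open>u\<close> and \<open>v\<close> are neighbours of each other, the vertices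
  outside \<open>N i v \<union> N i u\<close> are exactly the common neighbours in the other
  colour.\<close>

lemma common_nbhd:
  assumes "v \<in> V" "u \<in> N i v" "a < card (N i v)" "b < card (N i u)"
  shows "\<delta> \<le> card (N (\<not> i) v \<inter> N (\<not> i) u)"
proof -
  have u: "u \<in> V" "u \<noteq> v" "c {v, u} = i" using assms(2) by (auto simp: nbhd_def)
  have "N (\<not> i) v \<inter> N (\<not> i) u = V - (N i v \<union> N i u)"
    using u assms(1) by (auto simp: nbhd_def insert_commute)
  moreover have "card (N i v \<union> N i u) \<le> a + b + 1"
    using star_free[of v u i] assms u by auto
  moreover have "card (V - (N i v \<union> N i u)) = card V - card (N i v \<union> N i u)"
    using N_subset by (intro card_Diff_subset) auto
  ultimately show ?thesis using card_V by simp
qed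

text \<open>Since \<open>v\<close> lies in \<open>N i u\<close>, the two neighbourhoods together
  have at least \<open>a + b + 2\<close> vertices.\<close>

lemma card_nbr_le:
  assumes "v \<in> V" "a + b < card (N i v)" "u \<in> N i v" shows "card (N i u) \<le> b"
proof (rule ccontr)
  assume "\<not> ?thesis"
  then have "card (N i v \<union> N i u) \<le> a + b + 1"
    using star_free[of v u i] assms by (auto simp: nbhd_def)
  moreover have "insert v (N i v) \<subseteq> N i v \<union> N i u"
    using assms N_sym N_subset by blast
  then have "card (insert v (N i v)) \<le> card (N i v \<union> N i u)"
    by (intro card_mono) auto
  ultimately show False using assms(2) by simp
qed

lemma card_N_le:
  assumes "v \<in> V" shows "card (N i v) \<le> a + b"
proof (rule ccontr)
  assume "\<not> ?thesis"
  then have large: "a + b < card (N i v)" by simp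
  then obtain u where u: "u \<in> N i v" by (metis card.empty equals0I not_less_zero)
  then have uV: "u \<in> V" using N_subset by blast
  have *: "card (N i w) \<le> b" "a + b < card (N (\<not> i) w)" if "w \<in> N i v" for w
    using card_nbr_le[OF assms large that] card_N_add[of w i] that b_less N_subset by force+
  \<comment> \<open>At most \<open>b\<close> vertices of \<open>N i v\<close> are joined to
    \<open>u\<close> in colour \<open>i\<close>, so some \<open>w\<close> among them is joined to
    \<open>u\<close> in the other colour. There both \<open>u\<close> and \<open>w\<close> have
    degree above \<open>a + b\<close>, against \<open>card_nbr_le\<close>.\<close>
  have "N i v - {u} \<subseteq> N i u" if "N i v \<inter> N (\<not> i) u = {}"
    using that by (auto simp: nbhd_def)
  then have "card (N i v) - 1 \<le> card (N i u)" if "N i v \<inter> N (\<not> i) u = {}"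
    using that card_mono[of "N i u" "N i v - {u}"] u by simp
  then obtain w where w: "w \<in> N i v" "w \<in> N (\<not> i) u"
    using *(1)[OF u] large a_pos by fastforce
  then have "card (N (\<not> i) w) \<le> b"
    using card_nbr_le uV *(2)[OF u] by blast
  with *(2)[OF w(1)] show False by simp
qed

lemma card_N_ge: "v \<in> V \<Longrightarrow> \<delta> \<le> card (N i v)"
  using card_N_add[of v i] card_N_le[of v "\<not> i"] by simp

lemma common_nbhd_large:
  assumes "v \<in> V" "u \<in> N i v" "a < card (N i v)"
  shows "\<delta> \<le> card (N (\<not> i) v \<inter> N (\<not> i) u)"
  using common_nbhd assms card_N_ge[of u i] b_less N_subset
  by (meson order_less_le_trans subsetD)

lemma sum_card_N_swap:
  assumes "X \<subseteq> V" "Y \<subseteq> V"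
  shows "(\<Sum>x\<in>X. card (Y \<inter> N i x)) = (\<Sum>y\<in>Y. card (X \<inter> N i y))"
proof -
  have fin: "finite X" "finite Y" using assms finite_V by (auto intro: finite_subset)
  have "(\<Sum>x\<in>X. card (Y \<inter> N i x)) = (\<Sum>x\<in>X. \<Sum>y\<in>Y. if y \<in> N i x then 1 else 0)"
    using fin by (simp add: sum.If_cases)
  also have "\<dots> = (\<Sum>y\<in>Y. \<Sum>x\<in>X. if y \<in> N i x then 1 else 0)"
    by (rule sum.swap)
  also have "\<dots> = (\<Sum>y\<in>Y. \<Sum>x\<in>X. if x \<in> N i y then 1 else 0)"
    using assms N_sym by (intro sum.cong) (auto simp: subset_iff)
  also have "\<dots> = (\<Sum>y\<in>Y. card (X \<inter> N i y))"
    using fin by (simp add: sum.If_cases)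
  finally show ?thesis .
qed

text \<open>Counts the edges of colour \<open>\<not> i\<close> between the two neighbourhoods of
  \<open>v\<close> from either side.\<close>

lemma cross_count:
  assumes "v \<in> V" "a < card (N i v)"
  shows "card (N i v) * \<delta> \<le> (\<Sum>z\<in>N (\<not> i) v. card (N i v \<inter> N (\<not> i) z))"
proof -
  have "card (N i v) * \<delta> \<le> (\<Sum>u\<in>N i v. card (N (\<not> i) v \<inter> N (\<not> i) u))"
    using sum_bounded_below[of "N i v" \<delta>] common_nbhd_large[OF assms(1) _ assms(2)] by simp
  then show ?thesis by (simp add: sum_card_N_swap N_subset)
qed

text \<open>Otherwise \<open>cross_count\<close> applies in both colours, and the
  \<open>x * y\<close> edges between the two neighbourhoods number at least
  \<open>(x + y) * \<delta>\<close>. But \<open>x + y = a + b + \<delta> < 4 * \<delta>\<close> and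
  \<open>4 * x * y \<le> (x + y)\<^sup>2\<close>.\<close>

lemma not_both_large:
  assumes "v \<in> V" "a < card (N i v)" shows "card (N (\<not> i) v) \<le> a"
proof (rule ccontr)
  assume "\<not> ?thesis"
  then have large: "a < card (N (\<not> i) v)" by simp
  let ?W = "N i v" and ?S = "N (\<not> i) v"
  have 1: "card ?W * \<delta> \<le> (\<Sum>z\<in>?S. card (?W \<inter> N (\<not> i) z))"
    using cross_count assms .
  have "card ?S * \<delta> \<le> (\<Sum>z\<in>?W. card (?S \<inter> N i z))"
    using cross_count[OF assms(1) large] by simp
  then have 2: "card ?S * \<delta> \<le> (\<Sum>z\<in>?S. card (?W \<inter> N i z))"
    by (simp add: sum_card_N_swap N_subset)
  have "card (?W \<inter> N (\<not> i) z) + card (?W \<inter> N i z) \<le> card ?W" for z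
    by (subst card_Un_disjoint[symmetric]) (auto intro!: card_mono simp: nbhd_def)
  then have "(\<Sum>z\<in>?S. card (?W \<inter> N (\<not> i) z)) + (\<Sum>z\<in>?S. card (?W \<inter> N i z)) \<le> card ?S * card ?W"
    unfolding sum.distrib[symmetric] by (intro sum_bounded_above[of ?S _ "card ?W", simplified])
  with 1 2 have "(card ?W + card ?S) * \<delta> \<le> card ?W * card ?S"
    by (simp add: algebra_simps)
  moreover define x y where "x = int (card ?W)" and "y = int (card ?S)"
  ultimately have "(x + y) * int \<delta> \<le> x * y"
    by (metis of_nat_add of_nat_le_iff of_nat_mult)
  moreover have "(x + y) * (x + y) < (x + y) * (4 * int \<delta>)"
    using card_N_add[OF assms(1), of i] a_less b_less assms(2)
    unfolding x_def y_def by (intro mult_strict_left_mono) linarith+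
  moreover have "4 * (x * y) \<le> (x + y) * (x + y)"
    using zero_le_square[of "x - y"] by (simp add: algebra_simps)
  ultimately show False by linarith
qed

section \<open>Majority and minority colours\<close>

definition t where "t v \<longleftrightarrow> a < card (N True v)"
definition W where "W v = N (t v) v"
definition S where "S v = N (\<not> t v) v"

lemma W_S_subset: "W v \<subseteq> V" "S v \<subseteq> V" and finite_W_S [simp]: "finite (W v)" "finite (S v)"
  using N_subset by (auto simp: W_def S_def)

lemma card_W_S:
  assumes "v \<in> V" shows "a < card (W v)" "card (S v) \<le> a" "card (W v) + card (S v) = a + b + \<delta>"
proof -
  show 3: "card (W v) + card (S v) = a + b + \<delta>"
    unfolding W_def S_def using card_N_add assms .
  \<comment> \<open>If \<open>t v\<close> fails, colour \<open>False\<close> has degree at least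
    \<open>b + \<delta> > a\<close>; so the Boolean \<open>t v\<close> is itself the majority
    colour.\<close>
  show 1: "a < card (W v)"
    using a_less card_N_add[OF assms, of True] by (cases "t v") (auto simp: W_def t_def)
  then show "card (S v) \<le> a"
    unfolding W_def S_def using not_both_large assms by blast
qed

lemma common_majority:
  assumes "v \<in> V" "u \<in> W v" shows "\<delta> \<le> card (S v \<inter> N (\<not> t v) u)"
  using common_nbhd_large[of v u "t v"] assms card_W_S unfolding W_def S_def by blast

text \<open>The edge \<open>{v, w}\<close> has the majority colour of one end, say \<open>v\<close>.
  Then \<delta> vertices of \<open>S v\<close> are joined to \<open>w\<close> in the minority colour
  of \<open>v\<close>, which is the majority colour of \<open>w\<close>, so they avoid
  \<open>S w\<close>.\<close>

lemma card_S_Int_le: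
  assumes "v \<in> V" "w \<in> V" "t v \<noteq> t w" shows "card (S v \<inter> S w) + \<delta> \<le> a"
proof -
  have *: "card (S v \<inter> S w) + \<delta> \<le> a" if "v \<in> V" "w \<in> W v" "t v \<noteq> t w" for v w
  proof -
    have "card (S v \<inter> S w) + card (S v \<inter> N (\<not> t v) w) \<le> card (S v)"
      using that(3) by (subst card_Un_disjoint[symmetric]) (auto intro!: card_mono simp: S_def nbhd_def)
    then show ?thesis using common_majority[OF that(1,2)] card_W_S(2)[OF that(1)] by linarith
  qed
  have "w \<in> W v \<or> v \<in> W w"
    using assms by (auto simp: W_def nbhd_def insert_commute)
  then show ?thesis using * assms by (metis inf_commute)
qed

definition q where "q v = card {z \<in> S v. t z = t v}"

text \<open>Each \<open>z\<close> in \<open>S v\<close> of the type of \<open>v\<close> accounts for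
  at most \<open>a\<close> of the edges in \<open>cross_count\<close>. If \<open>z\<close> has the
  other type, \<open>v\<close> is a majority neighbour of \<open>z\<close>, so \<delta> vertices of
  \<open>W v\<close> are joined to \<open>z\<close> in the wrong colour. With few \<open>z\<close>
  of the first kind the total is too small.\<close>

lemma q_lower:
  assumes "v \<in> V" shows "a < q v + \<delta>"
proof (rule ccontr)
  assume neg: "\<not> ?thesis"
  let ?S1 = "{z \<in> S v. t z = t v}" and ?S2 = "{z \<in> S v. t z \<noteq> t v}"
  let ?k = "\<lambda>z. card (W v \<inter> N (\<not> t v) z)"
  have S_split: "S v = ?S1 \<union> ?S2" "?S1 \<inter> ?S2 = {}" by auto
  have "?k z \<le> a" if "z \<in> ?S1" for z
  proof -
    have "?k z \<le> card (S z)" using that by (auto intro!: card_mono simp: S_def)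
    also have "\<dots> \<le> a" using card_W_S that W_S_subset by blast
    finally show ?thesis .
  qed
  then have 1: "sum ?k ?S1 \<le> q v * a"
    unfolding q_def using sum_bounded_above[of ?S1 ?k a] by simp
  have "?k z \<le> card (W v) - \<delta>" if z: "z \<in> ?S2" for z
  proof -
    have zV: "z \<in> V" using z W_S_subset by blast
    have "v \<in> W z" using z zV assms by (auto simp: W_def S_def nbhd_def insert_commute)
    then have "\<delta> \<le> card (S z \<inter> W v)"
      using common_majority[OF zV] z by (auto simp: W_def)
    moreover have "card (S z \<inter> W v) + ?k z \<le> card (W v)"
      using z by (subst card_Un_disjoint[symmetric]) (auto intro!: card_mono simp: S_def nbhd_def)
    ultimately show ?thesis by linarith
  qed
  then have 2: "sum ?k ?S2 \<le> card ?S2 * (card (W v) - \<delta>)"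
    using sum_bounded_above[of ?S2 ?k "card (W v) - \<delta>"] by simp
  have cS: "card (S v) = q v + card ?S2"
    unfolding q_def by (subst S_split(1), subst card_Un_disjoint) auto
  have "card (W v) * \<delta> \<le> sum ?k (S v)"
    using cross_count[OF assms, of "t v"] card_W_S(1)[OF assms] by (simp add: W_def S_def)
  also have "\<dots> = sum ?k ?S1 + sum ?k ?S2"
    by (subst S_split(1), subst sum.union_disjoint) auto
  finally have "card (W v) * \<delta> \<le> q v * a + card ?S2 * (card (W v) - \<delta>)"
    using 1 2 by linarith
  moreover have dge: "b + \<delta> \<le> card (W v)" using card_W_S[OF assms] by linarith
  moreover define d Q s where "d = int (card (W v))" and "Q = int (q v)" and "s = int (card ?S2)"
  ultimately have main: "d * int \<delta> \<le> Q * int a + s * (d - int \<delta>)"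
    by (simp flip: of_nat_mult of_nat_add of_nat_diff)
  have s: "s = int a + int b + int \<delta> - d - Q"
    using cS card_W_S(3)[OF assms] unfolding d_def Q_def s_def by linarith
  have "d \<le> int a + int b"
    using card_N_le[OF assms] unfolding d_def W_def by (metis of_nat_add of_nat_le_iff)
  moreover have d: "int b + int \<delta> \<le> d" using dge unfolding d_def by linarith
  \<comment> \<open>The coefficient of \<open>Q\<close> is positive, as \<open>d \<le> a + b\<close>
    and \<open>b < \<delta>\<close>. Dropping the nonnegative product below, \<open>main\<close>
    shrinks to \<open>\<delta>\<^sup>2 + a * \<delta> \<le> a\<^sup>2\<close>, which
    \<open>quad\<close> excludes because \<open>b < \<delta>\<close>.\<close>
  ultimately have "Q * (int a + int \<delta> - d) \<le> (int a - int \<delta>) * (int a + int \<delta> - d)"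
    using neg b_less unfolding Q_def by (intro mult_right_mono) linarith+
  moreover have "2 * (int a * int a) \<le> int \<delta> * (2 * int a + int b + int \<delta>)"
  proof -
    have "int (2 * a\<^sup>2) \<le> int (\<delta> * (2 * a + b + \<delta>))"
      using quad by (simp only: of_nat_le_iff)
    then show ?thesis by (simp add: power2_eq_square)
  qed
  moreover have "int \<delta> * int b < int \<delta> * int \<delta>"
    using b_less by (intro mult_strict_left_mono) auto
  moreover have "0 \<le> (d - int b - int \<delta>) * (d - int \<delta>)"
    using d by simp
  ultimately show False
    using main unfolding s by (simp add: algebra_simps)
qed

lemma same_majority:
  assumes "v \<in> V" "w \<in> V" shows "t v = t w"
proof -
  define A where "A = {v \<in> V. t v}"
  define B where "B = {v \<in> V. \<not> t v}"
  have AB: "A \<subseteq> V" "B \<subseteq> V" "V = A \<union> B" "A \<inter> B = {}" by (auto simp: A_def B_def)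
  have fin: "finite A" "finite B" using AB finite_V by (auto intro: finite_subset)
  have "False" if ne: "A \<noteq> {}" "B \<noteq> {}"
  proof -
    \<comment> \<open>\<open>?l z\<close> and \<open>?r z\<close> count the vertices of
      \<open>A\<close> and of \<open>B\<close> whose minority neighbourhoods contain
      \<open>z\<close>; the count over the type of \<open>z\<close> itself is
      \<open>q z\<close>.\<close>
    let ?r = "\<lambda>z. card (B \<inter> N True z)" and ?l = "\<lambda>z. card (A \<inter> N False z)"
    have "(\<Sum>x\<in>A. \<Sum>y\<in>B. card (S x \<inter> S y)) = (\<Sum>x\<in>A. \<Sum>y\<in>B. \<Sum>z\<in>V. of_bool (z \<in> S x \<and> z \<in> S y))"
    proof (intro sum.cong refl)
      fix x y
      have "V \<inter> {z. z \<in> S x \<and> z \<in> S y} = S x \<inter> S y" using W_S_subset by blast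
      then show "card (S x \<inter> S y) = (\<Sum>z\<in>V. of_bool (z \<in> S x \<and> z \<in> S y))"
        using finite_V by (simp add: of_bool_def sum.If_cases)
    qed
    also have "\<dots> = (\<Sum>x\<in>A. \<Sum>z\<in>V. \<Sum>y\<in>B. of_bool (z \<in> S x \<and> z \<in> S y))"
      by (intro sum.cong refl sum.swap)
    also have "\<dots> = (\<Sum>z\<in>V. \<Sum>x\<in>A. \<Sum>y\<in>B. of_bool (z \<in> S x \<and> z \<in> S y))"
      by (rule sum.swap)
    also have "\<dots> = (\<Sum>z\<in>V. (\<Sum>x\<in>A. of_bool (z \<in> S x)) * (\<Sum>y\<in>B. of_bool (z \<in> S y)))"
      by (simp add: sum_product of_bool_conj)
    also have "\<dots> = (\<Sum>z\<in>V. ?l z * ?r z)"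
    proof (intro sum.cong refl arg_cong2[where f = "(*)"])
      fix z assume z: "z \<in> V"
      have "A \<inter> {x. z \<in> S x} = A \<inter> N False z" "B \<inter> {y. z \<in> S y} = B \<inter> N True z"
        using z by (auto simp: S_def A_def B_def nbhd_def insert_commute)
      then show "(\<Sum>x\<in>A. of_bool (z \<in> S x)) = ?l z" "(\<Sum>y\<in>B. of_bool (z \<in> S y)) = ?r z"
        using fin by (simp_all add: of_bool_def sum.If_cases)
    qed
    also have "\<dots> = (\<Sum>z\<in>A. q z * ?r z) + (\<Sum>z\<in>B. q z * ?l z)"
    proof -
      have "?l z = q z" if "z \<in> A" for z
        unfolding q_def using that by (intro arg_cong[where f = card]) (auto simp: A_def S_def nbhd_def)
      moreover have "?r z = q z" if "z \<in> B" for z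
        unfolding q_def using that by (intro arg_cong[where f = card]) (auto simp: B_def S_def nbhd_def)
      ultimately show ?thesis
        unfolding AB(3) by (subst sum.union_disjoint[OF fin AB(4)]) (simp add: mult.commute)
    qed
    finally have count: "(\<Sum>x\<in>A. \<Sum>y\<in>B. card (S x \<inter> S y)) = (\<Sum>z\<in>A. q z * ?r z) + (\<Sum>z\<in>B. q z * ?l z)" .
    \<comment> \<open>An edge between \<open>A\<close> and \<open>B\<close> is counted at its end in
      \<open>A\<close> if its colour is \<open>True\<close>, and at its end in \<open>B\<close>
      otherwise.\<close>
    have cross: "(\<Sum>z\<in>A. ?r z) + (\<Sum>z\<in>B. ?l z) = card A * card B"
    proof -
      have "(\<Sum>z\<in>B. ?l z) = (\<Sum>z\<in>A. card (B \<inter> N False z))"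
        by (rule sum_card_N_swap) (use AB in auto)
      moreover have "?r z + card (B \<inter> N False z) = card B" if "z \<in> A" for z
        using fin that AB by (subst card_Un_disjoint[symmetric])
          (auto intro!: arg_cong[where f = card] simp: nbhd_def)
      ultimately show ?thesis by (simp flip: sum.distrib)
    qed
    have "(\<Sum>x\<in>A. \<Sum>y\<in>B. card (S x \<inter> S y)) \<le> (\<Sum>x\<in>A. \<Sum>y\<in>B. a - \<delta>)"
      using card_S_Int_le by (intro sum_mono) (fastforce simp: A_def B_def)
    then have upper: "(\<Sum>x\<in>A. \<Sum>y\<in>B. card (S x \<inter> S y)) \<le> card A * card B * (a - \<delta>)"
      by simp
    have q: "a - \<delta> + 1 \<le> q z" if "z \<in> V" for z
    proof -
      \<comment> \<open>Subtraction truncates, so \<open>\<delta> \<le> a\<close> is needed; one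
        pair of vertices of different types supplies it.\<close>
      obtain x y where "x \<in> A" "y \<in> B" using ne by auto
      then have "\<delta> \<le> a" using card_S_Int_le[of x y] by (auto simp: A_def B_def)
      then show ?thesis using q_lower[OF that] by linarith
    qed
    have "card A * card B * (a - \<delta> + 1) = (\<Sum>z\<in>A. (a - \<delta> + 1) * ?r z) + (\<Sum>z\<in>B. (a - \<delta> + 1) * ?l z)"
      unfolding cross[symmetric] by (simp add: sum_distrib_left algebra_simps sum.distrib)
    also have "\<dots> \<le> (\<Sum>z\<in>A. q z * ?r z) + (\<Sum>z\<in>B. q z * ?l z)"
      using q AB by (intro add_mono sum_mono mult_right_mono) auto
    finally have "card A * card B * (a - \<delta> + 1) \<le> card A * card B * (a - \<delta>)"
      using count upper by linarith
    then show False using ne fin by simp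
  qed
  then show ?thesis using assms by (auto simp: A_def B_def)
qed

section \<open>A single majority colour\<close>

lemma contradiction: False
proof -
  obtain v where v: "v \<in> V" using card_V by (metis Suc_eq_plus1 card.empty equals0I nat.distinct(1))
  let ?k = "\<lambda>z. card (W v \<inter> S z)"
  have t: "t z = t v" if "z \<in> V" for z using same_majority that v by blast
  have tS: "N (\<not> t v) z = S z" if "z \<in> V" for z using t[OF that] by (simp add: S_def)
  have count: "card (W v) * \<delta> \<le> sum ?k (S v)"
  proof -
    have "card (W v) * \<delta> \<le> (\<Sum>z\<in>S v. card (W v \<inter> N (\<not> t v) z))"
      using cross_count[OF v, of "t v"] card_W_S(1)[OF v] by (simp add: W_def S_def)
    also have "\<dots> = sum ?k (S v)" using tS W_S_subset by (intro sum.cong) (auto simp: subset_iff)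
    finally show ?thesis .
  qed
  have k_le: "?k z + 2 * \<delta> + 1 \<le> 2 * a" if z: "z \<in> S v" for z
  proof -
    have zV: "z \<in> V" using z W_S_subset by blast
    have vz: "v \<in> S z" "v \<notin> W z"
      using z zV v t[OF zV] by (auto simp: S_def W_def nbhd_def insert_commute)
    \<comment> \<open>One set has more than \<open>a\<close> vertices, the other at least
      \<open>b + \<delta>\<close>, and both avoid \<open>v\<close>.\<close>
    have "W v \<inter> W z \<noteq> {}"
    proof
      assume "W v \<inter> W z = {}"
      then have "card (W v) + card (W z) = card (W v \<union> W z)"
        by (simp add: card_Un_disjoint)
      also have "\<dots> \<le> card (V - {v})"
        using finite_V W_S_subset vz(2) by (intro card_mono) (auto simp: W_def nbhd_def)
      also have "\<dots> = a + b + \<delta>" using v card_V by simp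
      finally show False
        using card_W_S[OF v] card_W_S[OF zV] a_less by linarith
    qed
    then obtain u where u: "u \<in> W v" "u \<in> W z" by blast
    then have uV: "u \<in> V" using W_S_subset by blast
    \<comment> \<open>Inside \<open>S u\<close>, of size at most \<open>a\<close>, these two sets
      overlap in at least \<open>2 * \<delta> - a\<close> vertices. In \<open>S z\<close> that
      overlap, the \<open>?k z\<close> vertices of \<open>W v\<close> and \<open>v\<close> itself
      are disjoint.\<close>
    have "\<delta> \<le> card (S v \<inter> S u)" "\<delta> \<le> card (S z \<inter> S u)"
      using common_majority[OF v u(1)] common_majority[OF zV u(2)] tS[OF uV] t[OF zV] by simp_all
    moreover have "card (S v \<inter> S u) + card (S z \<inter> S u)
        = card ((S v \<inter> S u) \<union> (S z \<inter> S u)) + card ((S v \<inter> S u) \<inter> (S z \<inter> S u))"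
      by (intro card_Un_Int) auto
    moreover have "card ((S v \<inter> S u) \<union> (S z \<inter> S u)) \<le> card (S u)"
      by (intro card_mono) auto
    moreover have "card ((S v \<inter> S u) \<inter> (S z \<inter> S u)) \<le> card (S z \<inter> S v)"
      by (intro card_mono) auto
    moreover have "?k z + card (S z \<inter> S v) + 1 \<le> card (S z)"
    proof -
      have "card ((W v \<inter> S z) \<union> (S z \<inter> S v) \<union> {v}) = card ((W v \<inter> S z) \<union> (S z \<inter> S v)) + 1"
        by (subst card_Un_disjoint) (auto simp: W_def S_def)
      moreover have "card ((W v \<inter> S z) \<union> (S z \<inter> S v)) = ?k z + card (S z \<inter> S v)"
        by (subst card_Un_disjoint) (auto simp: W_def S_def nbhd_def)
      moreover have "card ((W v \<inter> S z) \<union> (S z \<inter> S v) \<union> {v}) \<le> card (S z)"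
        using vz by (intro card_mono) auto
      ultimately show ?thesis by simp
    qed
    ultimately show ?thesis
      using card_W_S(2)[OF uV] card_W_S(2)[OF zV] by linarith
  qed
  have "S v \<noteq> {}"
    using card_N_ge[OF v, of "\<not> t v"] b_less by (auto simp: S_def)
  then have \<delta>_less: "2 * \<delta> + 1 \<le> 2 * a" using k_le by fastforce
  \<comment> \<open>By \<open>\<delta>_less\<close> this subtraction is exact. The final 1 stems
    from \<open>v\<close> in \<open>k_le\<close> and yields the extra summand \<open>a\<close> that
    contradicts \<open>quad\<close>.\<close>
  define K where "K = 2 * a - 2 * \<delta> - 1"
  have "sum ?k (S v) \<le> card (S v) * K"
    using sum_bounded_above[of "S v" ?k K] k_le unfolding K_def by fastforce
  also have "\<dots> \<le> a * K"
    using card_W_S(2)[OF v] by simp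
  finally have "(b + \<delta>) * \<delta> \<le> a * K"
    using count card_W_S(2,3)[OF v] mult_le_mono1[of "b + \<delta>" "card (W v)" \<delta>] by linarith
  moreover have "a * K + 2 * (a * \<delta>) + a = 2 * a\<^sup>2"
  proof -
    have "K + 2 * \<delta> + 1 = 2 * a" using \<delta>_less K_def by simp
    then have "a * (K + 2 * \<delta> + 1) = a * (2 * a)" by simp
    then show ?thesis by (simp add: algebra_simps power2_eq_square)
  qed
  ultimately show False using quad a_pos by (simp add: algebra_simps)
qed

end

section \<open>The Ramsey bound and its numerical case\<close>

lemma ramsey_double_star_le:
  assumes "0 < a" "b < \<delta>" "a < b + \<delta>" "2 * a\<^sup>2 \<le> \<delta> * (2 * a + b + \<delta>)"
  shows "ramsey_number (double_star a b) \<le> a + b + \<delta> + 1"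
proof -
  let ?n = "a + b + \<delta> + 1"
  have "\<exists>i. contains_copy (colour_class ?n c i) (double_star a b)" for c
  proof (rule ccontr)
    assume "\<not> ?thesis"
    then have "double_star_free {..<?n} c a b \<delta>"
      using assms contains_copy_double_star[of _ ?n _ c _ a b]
      by unfold_locales (auto simp: not_less[symmetric])
    then show False by (rule double_star_free.contradiction)
  qed
  then show ?thesis
    unfolding ramsey_number_def ramsey_arrows_def by (intro Least_le) blast
qed

theorem corollary3:
  fixes m :: nat
  assumes "m > 0"
  shows "int (ramsey_number (double_star (2 * m) m)) \<le> \<lceil>4.27492 * real m\<rceil> + 1"
proof -
  define x where "x = \<lceil>4.27492 * real m\<rceil>"
  \<comment> \<open>Makes \<open>a + b + \<delta> + 1\<close> equal to \<open>x + 1\<close> for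
    \<open>a = 2 * m\<close> and \<open>b = m\<close>.\<close>
  define \<delta> where "\<delta> = nat (x - 3 * int m)"
  have x: "427492 * real m \<le> 100000 * of_int x"
    using le_of_int_ceiling[of "4.27492 * real m"] unfolding x_def[symmetric] by simp
  then have \<delta>: "int \<delta> = x - 3 * int m" by (simp add: \<delta>_def)
  then have d: "127492 / 100000 * real m \<le> real \<delta>" using x by linarith
  \<comment> \<open>The factor 1.27492 = 4.27492 - 3 lies just above the positive root of
    \<open>t * (5 + t) = 8\<close>.\<close>
  have "8 * (real m)\<^sup>2 \<le> (127492 / 100000 * real m) * (5 * real m + 127492 / 100000 * real m)"
    by (simp add: power2_eq_square)
  also have "\<dots> \<le> real \<delta> * (5 * real m + real \<delta>)"
    using d by (intro mult_mono) auto
  finally have "real (2 * (2 * m)\<^sup>2) \<le> real (\<delta> * (2 * (2 * m) + m + \<delta>))"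
    by (simp add: algebra_simps power2_eq_square)
  then have "2 * (2 * m)\<^sup>2 \<le> \<delta> * (2 * (2 * m) + m + \<delta>)" by (simp only: of_nat_le_iff)
  moreover have "m < \<delta>" using d assms by linarith
  ultimately have "ramsey_number (double_star (2 * m) m) \<le> 2 * m + m + \<delta> + 1"
    using assms by (intro ramsey_double_star_le) auto
  then show ?thesis using \<delta> unfolding x_def by linarith
qed

end
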